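(* Let $G$ be a finite non-abelian AC-group, and let $X_1,\dots,X_n$ be the distinct centralizers of non-central elements of $G$. Then the spectrum of the commuting graph $\Gamma_G$ of $G$ is $$\left\{(-1)^{\sum_{i=1}^{n}|X_i| - n(|Z(G)|+1)},\ (|X_1|-|Z(G)|-1)^1,\ \dots,\ (|X_n|-|Z(G)|-1)^1\right\}.$$
   Context: For a finite non-abelian group $G$ with centre $Z(G)$, the commuting graph $\Gamma_G$ is the simple undirected graph with vertex set $G\setminus Z(G)$ in which two distinct vertices $x,y$ are adjacent if and only if $xy=yx$. $G$ is called an AC-group if the centralizer $C_G(x)$ is abelian for every $x\in G\setminus Z(G)$. The spectrum of a graph is the multiset of eigenvalues of its adjacency matrix, written $\{\lambda_1^{k_1},\dots,\lambda_r^{k_r}\}$, where $\lambda^{k}$ denotes that $\lambda$ is listed $k$ times (listed values may coincide, in which case multiplicities add). *)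

theory Defs
  imports
    "HOL-Algebra.Group"
    "Graph_Theory.Pair_Digraph"
    "Jordan_Normal_Form.Char_Poly"
    "HOL-Computational_Algebra.Fundamental_Theorem_Algebra"
begin

definition centralizer :: "('a, 'b) monoid_scheme \<Rightarrow> 'a \<Rightarrow> 'a set" where
  "centralizer G x = {y \<in> carrier G. x \<otimes>\<^bsub>G\<^esub> y = y \<otimes>\<^bsub>G\<^esub> x}"

definition group_center :: "('a, 'b) monoid_scheme \<Rightarrow> 'a set" where
  "group_center G = {z \<in> carrier G. \<forall>y \<in> carrier G. z \<otimes>\<^bsub>G\<^esub> y = y \<otimes>\<^bsub>G\<^esub> z}"

locale AC_group = group G for G (structure) +
  assumes centralizer_abelian:
    "x \<in> carrier G - group_center G \<Longrightarrow> comm_group (G\<lparr>carrier := centralizer G x\<rparr>)"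

text \<open>Simple graphs are represented by the symmetric, loop-free digraphs of
  \<^locale>\<open>pair_graph\<close>: each edge is the pair of its two opposite arcs.\<close>

definition commuting_graph :: "('a, 'b) monoid_scheme \<Rightarrow> 'a pair_pre_digraph" where
  "commuting_graph G =
    \<lparr> pverts = carrier G - group_center G,
      parcs = {(x, y). x \<in> carrier G - group_center G \<and> y \<in> carrier G - group_center G \<and>
                       x \<noteq> y \<and> x \<otimes>\<^bsub>G\<^esub> y = y \<otimes>\<^bsub>G\<^esub> x} \<rparr>"

lemma pair_graph_commuting_graph:
  assumes "finite (carrier G)"
  shows "pair_graph (commuting_graph G)"
proof -
  have "finite (parcs (commuting_graph G))"
    by (rule finite_subset[of _ "carrier G \<times> carrier G"])
       (use assms in \<open>auto simp: commuting_graph_def\<close>)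
  then show ?thesis
    using assms
    by unfold_locales
       (auto simp: commuting_graph_def symmetric_def intro!: symI)
qed

text \<open>The adjacency matrix with respect to an enumeration \<open>vs\<close> of the vertices.\<close>

definition adjacency_matrix :: "'a pair_pre_digraph \<Rightarrow> 'a list \<Rightarrow> complex mat" where
  "adjacency_matrix \<Gamma> vs =
    mat (length vs) (length vs) (\<lambda>(i, j). if (vs ! i, vs ! j) \<in> parcs \<Gamma> then 1 else 0)"

text \<open>Eigenvalues are counted with their multiplicity as roots of the characteristic polynomial,
  over the complex numbers so that there are as many of them as vertices.  The choice of the
  enumeration is immaterial, see \<open>graph_spectrum_eq\<close> below.\<close>

definition graph_spectrum :: "'a pair_pre_digraph \<Rightarrow> complex multiset" where
  "graph_spectrum \<Gamma> =
    proots (char_poly (adjacency_matrix \<Gamma> (SOME vs. distinct vs \<and> set vs = pverts \<Gamma>)))"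

definition kernel_mat :: "('a \<Rightarrow> 'a \<Rightarrow> complex) \<Rightarrow> 'a list \<Rightarrow> 'a list \<Rightarrow> complex mat" where
  "kernel_mat f vs ws = mat (length vs) (length ws) (\<lambda>(i, j). f (vs ! i) (ws ! j))"

lemma kernel_mat_mult:
  assumes "distinct ws"
  shows "kernel_mat f vs ws * kernel_mat g ws us =
         kernel_mat (\<lambda>x y. \<Sum>z\<in>set ws. f x z * g z y) vs us"
proof (rule eq_matI)
  fix i j
  assume "i < dim_row (kernel_mat (\<lambda>x y. \<Sum>z\<in>set ws. f x z * g z y) vs us)"
    and "j < dim_col (kernel_mat (\<lambda>x y. \<Sum>z\<in>set ws. f x z * g z y) vs us)"
  then have ij: "i < length vs" "j < length us" by (auto simp: kernel_mat_def)
  have "bij_betw ((!) ws) {0..<length ws} (set ws)"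
    using assms by (intro bij_betw_nth) auto
  then have "(\<Sum>k = 0..<length ws. f (vs ! i) (ws ! k) * g (ws ! k) (us ! j)) =
             (\<Sum>z\<in>set ws. f (vs ! i) z * g z (us ! j))"
    by (rule sum.reindex_bij_betw)
  then show "(kernel_mat f vs ws * kernel_mat g ws us) $$ (i, j) =
      kernel_mat (\<lambda>x y. \<Sum>z\<in>set ws. f x z * g z y) vs us $$ (i, j)"
    using ij by (simp add: kernel_mat_def scalar_prod_def)
qed (auto simp: kernel_mat_def)

lemma kernel_mat_cong:
  assumes "\<And>x y. x \<in> set vs \<Longrightarrow> y \<in> set ws \<Longrightarrow> f x y = g x y"
  shows "kernel_mat f vs ws = kernel_mat g vs ws"
  by (rule eq_matI) (auto simp: kernel_mat_def assms)

lemma similar_adjacency_matrix: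
  assumes "distinct vs" "distinct ws" "set vs = set ws"
  shows "similar_mat (adjacency_matrix \<Gamma> vs) (adjacency_matrix \<Gamma> ws)"
proof -
  define a where "a x y = (if (x, y) \<in> parcs \<Gamma> then 1 else 0 :: complex)" for x y
  define d where "d x y = (if x = y then 1 else 0 :: complex)" for x y :: 'a
  have adj: "adjacency_matrix \<Gamma> us = kernel_mat a us us" for us
    by (simp add: adjacency_matrix_def kernel_mat_def a_def)
  have one: "kernel_mat d us us = 1\<^sub>m (length us)" if "distinct us" for us
    by (rule eq_matI) (use that in \<open>auto simp: kernel_mat_def d_def nth_eq_iff_index_eq\<close>)
  have dd: "kernel_mat d us us' * kernel_mat d us' us = 1\<^sub>m (length us)"
    if "distinct us" "distinct us'" "set us = set us'" for us us'
  proof -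
    have "kernel_mat d us us' * kernel_mat d us' us = kernel_mat d us us"
      unfolding kernel_mat_mult[OF that(2)]
      by (rule kernel_mat_cong)
         (use that in \<open>auto simp: d_def if_distrib[of "\<lambda>t. t * _"] cong: if_cong\<close>)
    then show ?thesis using one[OF that(1)] by simp
  qed
  have "kernel_mat d vs ws * kernel_mat a ws ws = kernel_mat a vs ws"
    unfolding kernel_mat_mult[OF assms(2)]
    by (rule kernel_mat_cong)
       (use assms in \<open>auto simp: d_def if_distrib[of "\<lambda>t. t * _"] cong: if_cong\<close>)
  moreover have "kernel_mat a vs ws * kernel_mat d ws vs = kernel_mat a vs vs"
    unfolding kernel_mat_mult[OF assms(2)]
    by (rule kernel_mat_cong)
       (use assms in \<open>auto simp: d_def if_distrib[of "\<lambda>t. _ * t"] cong: if_cong\<close>)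
  moreover have len: "length vs = length ws"
    using assms by (metis distinct_card)
  ultimately show ?thesis
    unfolding adj
    using dd[OF assms] dd[OF assms(2,1) assms(3)[symmetric]]
    by (intro similar_matI[of _ _ "kernel_mat d vs ws" "kernel_mat d ws vs" "length vs"])
       (auto simp: kernel_mat_def)
qed

lemma graph_spectrum_eq:
  assumes "distinct vs" "set vs = pverts \<Gamma>"
  shows "graph_spectrum \<Gamma> = proots (char_poly (adjacency_matrix \<Gamma> vs))"
proof -
  let ?P = "\<lambda>us. distinct us \<and> set us = pverts \<Gamma>"
  have "?P (SOME us. ?P us)"
    using assms by (intro someI[of ?P vs]) simp
  then have "similar_mat (adjacency_matrix \<Gamma> (SOME us. ?P us)) (adjacency_matrix \<Gamma> vs)"
    using assms by (intro similar_adjacency_matrix) auto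
  then show ?thesis
    unfolding graph_spectrum_def by (simp add: char_poly_similar)
qed

lemma size_graph_spectrum:
  assumes "finite (pverts \<Gamma>)"
  shows "size (graph_spectrum \<Gamma>) = card (pverts \<Gamma>)"
proof -
  obtain vs where vs: "set vs = pverts \<Gamma>" "distinct vs"
    using finite_distinct_list[OF assms] by blast
  have "adjacency_matrix \<Gamma> vs \<in> carrier_mat (length vs) (length vs)"
    by (simp add: adjacency_matrix_def)
  then show ?thesis
    using vs degree_monic_char_poly
    by (metis distinct_card graph_spectrum_eq size_proots_complex)
qed

end

theory Submission
  imports Defs
begin

(* In an AC-group, a non-central element y of C(x) satisfies C(y) = C(x): the abelian group C(x) lies
   in C(y), and by symmetry C(y) lies in C(x).  Hence the sets X_i - Z(G) partition the vertices into
   the components of the commuting graph, each of them a complete graph, and the characteristic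
   polynomial is the product of those of the complete graphs. *)

section \<open>Characteristic polynomials of block matrices and disjoint unions\<close>

text \<open>Subtracting the matrix from the indeterminate times the identity keeps the zero block,
  so the determinant of a block triangular matrix splits.\<close>

lemma char_poly_four_block_mat_lower_left_zero:
  fixes A :: "'a :: idom mat"
  assumes "A \<in> carrier_mat n n" "B \<in> carrier_mat n m" "D \<in> carrier_mat m m"
  shows "char_poly (four_block_mat A B (0\<^sub>m m n) D) = char_poly A * char_poly D"
proof -
  have "char_poly_matrix (four_block_mat A B (0\<^sub>m m n) D) =
      four_block_mat (char_poly_matrix A) (map_mat (\<lambda>a. [:- a:]) B) (0\<^sub>m m n) (char_poly_matrix D)"
    using assms by (intro eq_matI) (auto simp: char_poly_matrix_def)
  then show ?thesis
    unfolding char_poly_def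
    using assms by (simp add: det_four_block_mat_lower_left_zero[where n = n and m = m])
qed

text \<open>Rows of the lower left block are indexed by \<open>ws\<close> and columns by
  \<open>vs\<close>, so the absence of arcs from \<open>ws\<close> to \<open>vs\<close> makes this
  block zero.\<close>

lemma char_poly_adjacency_matrix_append:
  assumes "\<And>x y. x \<in> set ws \<Longrightarrow> y \<in> set vs \<Longrightarrow> (x, y) \<notin> parcs \<Gamma>"
  shows "char_poly (adjacency_matrix \<Gamma> (vs @ ws)) =
    char_poly (adjacency_matrix \<Gamma> vs) * char_poly (adjacency_matrix \<Gamma> ws)"
proof -
  let ?B = "mat (length vs) (length ws) (\<lambda>(i, j). if (vs ! i, ws ! j) \<in> parcs \<Gamma> then 1 else 0)"
  have "adjacency_matrix \<Gamma> (vs @ ws) =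
      four_block_mat (adjacency_matrix \<Gamma> vs) ?B (0\<^sub>m (length ws) (length vs)) (adjacency_matrix \<Gamma> ws)"
    by (rule eq_matI) (auto simp: adjacency_matrix_def nth_append assms)
  then show ?thesis
    by (simp add: char_poly_four_block_mat_lower_left_zero adjacency_matrix_def)
qed

lemma char_poly_adjacency_matrix_concat:
  assumes "distinct is"
    and "\<And>i j x y. \<lbrakk>i \<in> set is; j \<in> set is; i \<noteq> j; x \<in> set (vs i); y \<in> set (vs j)\<rbrakk>
      \<Longrightarrow> (x, y) \<notin> parcs \<Gamma>"
  shows "char_poly (adjacency_matrix \<Gamma> (concat (map vs is))) =
    (\<Prod>i\<leftarrow>is. char_poly (adjacency_matrix \<Gamma> (vs i)))"
  using assms
proof (induction "is")
  case Nil
  then show ?case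
    by (simp add: char_poly_def adjacency_matrix_def)
next
  case (Cons i "is")
  \<comment> \<open>Distinctness keeps \<open>i\<close> out of \<open>is\<close>, so no arc leads
    from a later list back to \<open>vs i\<close>.\<close>
  have "char_poly (adjacency_matrix \<Gamma> (vs i @ concat (map vs is))) =
      char_poly (adjacency_matrix \<Gamma> (vs i)) * char_poly (adjacency_matrix \<Gamma> (concat (map vs is)))"
    using Cons.prems by (intro char_poly_adjacency_matrix_append) fastforce
  moreover have "char_poly (adjacency_matrix \<Gamma> (concat (map vs is))) =
      (\<Prod>i\<leftarrow>is. char_poly (adjacency_matrix \<Gamma> (vs i)))"
    using Cons.prems by (intro Cons.IH) auto
  ultimately show ?case
    by simp
qed

section \<open>Spectrum of a complete graph\<close>

lemma char_poly_complete_graph_matrix: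
  "char_poly (mat (Suc m) (Suc m) (\<lambda>(i, j). if i = j then 0 else 1 :: 'a :: field)) =
    [:- of_nat m, 1:] * [:1, 1:] ^ m"
proof -
  define A :: "'a mat" where
    "A = mat (Suc m) (Suc m) (\<lambda>(i, j). if i = j then 0 else 1)"
  \<comment> \<open>The all-ones vector and the unit vectors other than the first form a basis
    in which \<open>A\<close> is upper triangular.\<close>
  define P :: "'a mat" where
    "P = mat (Suc m) (Suc m) (\<lambda>(i, j). if j = 0 \<or> j = i then 1 else 0)"
  define Q :: "'a mat" where
    "Q = mat (Suc m) (Suc m) (\<lambda>(i, j). if i = j then 1 else if j = 0 then - 1 else 0)"
  \<comment> \<open>Column \<open>j\<close> of \<open>B\<close> holds the coordinates of the image
    of the \<open>j\<close>-th basis vector: \<open>A\<close> multiplies the all-ones vector by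
    \<open>m\<close> and sends the unit vector at \<open>j\<close> to the all-ones vector minus
    itself.\<close>
  define B :: "'a mat" where
    "B = mat (Suc m) (Suc m) (\<lambda>(i, j). if i = 0 then if j = 0 then of_nat m else 1
      else if i = j then - 1 else 0)"
  have carrier: "A \<in> carrier_mat (Suc m) (Suc m)" "B \<in> carrier_mat (Suc m) (Suc m)"
    "P \<in> carrier_mat (Suc m) (Suc m)" "Q \<in> carrier_mat (Suc m) (Suc m)"
    by (simp_all add: A_def B_def P_def Q_def)
  \<comment> \<open>Row \<open>i\<close> of \<open>P\<close> is supported on columns 0 and
    \<open>i\<close>, which coincide when \<open>i = 0\<close>.\<close>
  have row_P: "(\<Sum>k = 0..<Suc m. (if k = 0 \<or> k = i then 1 else 0) * f k) =
      (if i = 0 then f 0 else f 0 + f i)" if "i < Suc m" for i and f :: "nat \<Rightarrow> 'a"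
  proof -
    have "(\<Sum>k = 0..<Suc m. (if k = 0 \<or> k = i then 1 else 0) * f k) = (\<Sum>k\<in>{0, i}. f k)"
      using that by (intro sum.mono_neutral_cong_right) auto
    then show ?thesis by auto
  qed
  have PQ: "P * Q = 1\<^sub>m (Suc m)"
    by (rule eq_matI) (auto simp: P_def Q_def scalar_prod_def row_P simp del: sum.op_ivl_Suc)
  then have QP: "Q * P = 1\<^sub>m (Suc m)"
    using carrier by (intro mat_mult_left_right_inverse[of P "Suc m" Q]) auto
  have AP: "A * P = P * B"
  proof (rule eq_matI)
    fix i j
    assume "i < dim_row (P * B)" "j < dim_col (P * B)"
    then have ij: "i < Suc m" "j < Suc m"
      using carrier by auto
    have "(A * P) $$ (i, j) =
        (\<Sum>k = 0..<Suc m. (if i = k then 0 else 1) * (if j = 0 \<or> j = k then 1 else 0))"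
      using ij by (simp add: A_def P_def scalar_prod_def del: sum.op_ivl_Suc)
    \<comment> \<open>Only indices where both factors are 1 survive, so the entry becomes a
      cardinality.\<close>
    also have "\<dots> = (\<Sum>k \<in> {k \<in> {0..<Suc m} - {i}. j = 0 \<or> j = k}. 1)"
      by (intro sum.mono_neutral_cong_right) auto
    also have "\<dots> = (if j = 0 then of_nat m else if i = j then 0 else 1)"
    proof -
      have "{k \<in> {0..<Suc m} - {i}. j = 0 \<or> j = k} =
          (if j = 0 then {0..<Suc m} - {i} else if i = j then {} else {j})"
        using ij by auto
      then show ?thesis
        using ij by simp
    qed
    also have "\<dots> = (P * B) $$ (i, j)"
      using ij by (auto simp: P_def B_def scalar_prod_def row_P simp del: sum.op_ivl_Suc)
    finally show "(A * P) $$ (i, j) = (P * B) $$ (i, j)" .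
  qed (use carrier in auto)
  have "A = A * (P * Q)"
    using carrier by (simp add: PQ)
  also have "\<dots> = P * B * Q"
    using carrier by (simp flip: AP)
  finally have "similar_mat A B"
    using carrier PQ QP by (intro similar_matI[of _ _ P Q "Suc m"]) auto
  then have "char_poly A = char_poly B"
    by (rule char_poly_similar)
  also have "\<dots> = (\<Prod>a\<leftarrow>diag_mat B. [:- a, 1:])"
    using carrier(2) by (rule char_poly_upper_triangular) (auto simp: B_def upper_triangular_def)
  also have "diag_mat B = of_nat m # replicate m (- 1)"
    by (rule nth_equalityI) (auto simp: diag_mat_def B_def nth_Cons' simp del: upt_Suc)
  finally show ?thesis
    by (simp add: prod_list_replicate flip: A_def)
qed

text \<open>The order is written \<open>Suc m\<close> because the eigenvalue \<open>m\<close> occurs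
  as soon as there is one vertex, whereas the empty graph has no eigenvalue.\<close>

lemma proots_complete_graph:
  assumes "distinct vs" "length vs = Suc m"
    and "\<And>x y. x \<in> set vs \<Longrightarrow> y \<in> set vs \<Longrightarrow> (x, y) \<in> parcs \<Gamma> \<longleftrightarrow> x \<noteq> y"
  shows "proots (char_poly (adjacency_matrix \<Gamma> vs)) = add_mset (of_nat m) (replicate_mset m (- 1))"
proof -
  have "adjacency_matrix \<Gamma> vs = mat (Suc m) (Suc m) (\<lambda>(i, j). if i = j then 0 else 1)"
    using assms by (intro eq_matI) (auto simp: adjacency_matrix_def nth_eq_iff_index_eq)
  then have "proots (char_poly (adjacency_matrix \<Gamma> vs)) =
      proots ([:- of_nat m, 1:] * [:1, 1:] ^ m :: complex poly)"
    by (simp only: char_poly_complete_graph_matrix)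
  also have "\<dots> = add_mset (of_nat m) (repeat_mset m {#- 1#})"
    by (subst proots_mult) (auto simp: proots_power)
  also have "repeat_mset m {#- 1#} = (replicate_mset m (- 1) :: complex multiset)"
    by (rule multiset_eqI) auto
  finally show ?thesis .
qed

section \<open>Centralizers and adjacency in an AC-group\<close>

context AC_group
begin

lemma centralizer_eq:
  assumes "x \<in> carrier G - group_center G" "y \<in> carrier G - group_center G"
    and "y \<in> centralizer G x"
  shows "centralizer G y = centralizer G x"
proof -
  have sub: "centralizer G u \<subseteq> centralizer G v"
    if "u \<in> carrier G - group_center G" "v \<in> centralizer G u" for u v
  proof
    fix z
    assume z: "z \<in> centralizer G u"
    then have "v \<otimes> z = z \<otimes> v"
      using comm_monoid.m_comm[OF comm_group.axioms(1)[OF centralizer_abelian[OF that(1)]]] that(2)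
      by simp
    then show "z \<in> centralizer G v"
      using z by (simp add: centralizer_def)
  qed
  have "x \<in> centralizer G y"
    using assms by (auto simp: centralizer_def)
  then show ?thesis
    using assms sub[of x y] sub[of y x] by blast
qed

text \<open>This turns commutation of non-central elements into the equivalence relation of having
  the same centralizer, whose classes are then cliques with no arcs between them.\<close>

lemma commuting_graph_arc_iff:
  assumes "x \<in> carrier G - group_center G" "y \<in> carrier G - group_center G"
  shows "(x, y) \<in> parcs (commuting_graph G) \<longleftrightarrow> x \<noteq> y \<and> centralizer G x = centralizer G y"
proof -
  have "y \<in> centralizer G x \<longleftrightarrow> centralizer G x = centralizer G y"
  proof
    assume "centralizer G x = centralizer G y"
    then show "y \<in> centralizer G x"
      using assms by (auto simp: centralizer_def)
  qed (use assms centralizer_eq in blast)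
  then show ?thesis
    using assms by (auto simp: commuting_graph_def centralizer_def)
qed

end

section \<open>Assembling the spectrum from the cliques\<close>

text \<open>The multiplicity of -1 is a difference of natural numbers; the inequality stated
  alongside it guarantees that this difference is not truncated.\<close>

theorem theorem2p2:
  fixes G :: "('a, 'b) monoid_scheme" and X :: "nat \<Rightarrow> 'a set" and n :: nat
  assumes "AC_group G" and "finite (carrier G)" and "\<not> comm_group G"
    and "bij_betw X {1..n} (centralizer G ` (carrier G - group_center G))"
  shows "n * (card (group_center G) + 1) \<le> (\<Sum>i = 1..n. card (X i)) \<and>
    graph_spectrum (commuting_graph G) =
      replicate_mset ((\<Sum>i = 1..n. card (X i)) - n * (card (group_center G) + 1)) (- 1) +
      {# of_nat (card (X i)) - of_nat (card (group_center G)) - 1. i \<in># mset_set {1..n} #}"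
proof -
  interpret AC_group G by fact
  let ?Z = "group_center G" and ?V = "carrier G - group_center G" and ?\<Gamma> = "commuting_graph G"
  \<comment> \<open>One less than the order of the \<open>i\<close>-th clique: both its largest
    eigenvalue and its number of eigenvalues -1.\<close>
  define m where "m i = card (X i) - (card ?Z + 1)" for i
  have img: "X ` {1..n} = centralizer G ` ?V" and inj: "inj_on X {1..n}"
    using assms(4) by (auto simp: bij_betw_def)
  have block: "X i - ?Z = {x \<in> ?V. centralizer G x = X i}" if i: "i \<in> {1..n}" for i
  proof -
    obtain x where x: "x \<in> ?V" "X i = centralizer G x"
      using img i by blast
    have "y \<in> ?V \<and> centralizer G y = centralizer G x" if "y \<in> centralizer G x - ?Z" for y
    proof -
      have "y \<in> ?V"
        using that by (auto simp: centralizer_def)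
      then show ?thesis
        using centralizer_eq[OF x(1)] that by blast
    qed
    moreover have "y \<in> centralizer G y" if "y \<in> ?V" for y
      using that by (simp add: centralizer_def)
    ultimately show ?thesis
      unfolding x(2) by blast
  qed
  have finX: "finite (X i)" and ZX: "?Z \<subseteq> X i" and neX: "X i - ?Z \<noteq> {}" if i: "i \<in> {1..n}" for i
  proof -
    obtain x where x: "x \<in> ?V" "X i = centralizer G x"
      using img i by blast
    show "finite (X i)"
      unfolding x(2) centralizer_def using assms(2) by simp
    show "?Z \<subseteq> X i"
      unfolding x(2) using x(1) by (auto simp: centralizer_def group_center_def)
    show "X i - ?Z \<noteq> {}"
      unfolding block[OF i] using x by blast
  qed
  \<comment> \<open>Each block contains the non-central element whose centralizer is
    \<open>X i\<close>, so the subtraction in \<open>m\<close> is exact.\<close>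
  have cardX: "card (X i - ?Z) = Suc (m i) \<and> card (X i) = m i + (card ?Z + 1)"
    if i: "i \<in> {1..n}" for i
  proof -
    have "card (X i - ?Z) > 0"
      using neX[OF i] finX[OF i] by (simp add: card_gt_0_iff)
    moreover have "card (X i - ?Z) = card (X i) - card ?Z"
      using finX[OF i] ZX[OF i] by (meson card_Diff_subset finite_subset)
    ultimately show ?thesis
      by (auto simp: m_def)
  qed
  have sumX: "(\<Sum>i = 1..n. card (X i)) = (\<Sum>i = 1..n. m i) + n * (card ?Z + 1)"
  proof -
    have "(\<Sum>i = 1..n. card (X i)) = (\<Sum>i = 1..n. m i + (card ?Z + 1))"
      using cardX by (intro sum.cong) auto
    then show ?thesis
      by (simp only: sum.distrib sum_constant) simp
  qed
  \<comment> \<open>Each clique is enumerated separately; joining the lists gives a vertex order in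
    which the adjacency matrix is block diagonal.\<close>
  have "\<forall>i\<in>{1..n}. \<exists>us. set us = X i - ?Z \<and> distinct us"
    using finX by (intro ballI finite_distinct_list finite_Diff)
  from bchoice[OF this] obtain vs
    where vs: "\<And>i. i \<in> {1..n} \<Longrightarrow> set (vs i) = X i - ?Z \<and> distinct (vs i)"
    by blast
  have vertex: "x \<in> ?V \<and> centralizer G x = X i" if "i \<in> {1..n}" "x \<in> set (vs i)" for i x
    using vs[OF that(1)] block[OF that(1)] that(2) by blast
  have arc: "(x, y) \<in> parcs ?\<Gamma> \<longleftrightarrow> x \<noteq> y \<and> i = j"
    if "i \<in> {1..n}" "j \<in> {1..n}" "x \<in> set (vs i)" "y \<in> set (vs j)" for i j x y
    using commuting_graph_arc_iff[of x y] vertex[OF that(1,3)] vertex[OF that(2,4)]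
      inj_on_eq_iff[OF inj that(1,2)] by metis
  define js where "js = [1..<Suc n]"
  have set_js: "set js = {1..n}" and distinct_js: "distinct js"
    by (auto simp: js_def)
  have "distinct (concat (map vs js))"
  proof (subst distinct_concat_iff, safe)
    have ne: "vs i \<noteq> []" if "i \<in> {1..n}" for i
      using vs[OF that] neX[OF that] by auto
    have disj: "i = j" if "i \<in> {1..n}" "j \<in> {1..n}" "x \<in> set (vs i)" "x \<in> set (vs j)" for i j x
      using vertex[OF that(1,3)] vertex[OF that(2,4)] inj_on_eq_iff[OF inj that(1,2)] by metis
    \<comment> \<open>Disjoint lists could still be equal if both were empty; nonemptiness supplies
      the common element \<open>last (vs i)\<close>, which forces equal indices.\<close>
    have "inj_on vs {1..n}"
    proof (rule inj_onI)
      fix i j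
      assume ij: "i \<in> {1..n}" "j \<in> {1..n}" "vs i = vs j"
      then show "i = j"
        using disj[of i j "last (vs i)"] ne[of i] last_in_set[of "vs i"] by metis
    qed
    then show "distinct (removeAll [] (map vs js))"
      by (intro distinct_removeAll) (simp add: distinct_map set_js distinct_js)
    show "distinct ys" if "ys \<in> set (map vs js)" for ys
      using that vs by (auto simp: set_js)
    show "x \<in> {}"
      if "ys \<in> set (map vs js)" "zs \<in> set (map vs js)" "ys \<noteq> zs" "x \<in> set ys" "x \<in> set zs"
      for ys zs x
      using that disj unfolding set_map set_js by blast
  qed
  moreover have "set (concat (map vs js)) = pverts ?\<Gamma>"
  proof -
    have "set (concat (map vs js)) = (\<Union>i\<in>{1..n}. set (vs i))"
      by (simp add: set_js)
    also have "\<dots> = (\<Union>i\<in>{1..n}. {x \<in> ?V. centralizer G x = X i})"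
      using vs block by (intro SUP_cong) simp_all
    also have "\<dots> = {x \<in> ?V. centralizer G x \<in> X ` {1..n}}"
      by blast
    also have "\<dots> = ?V"
      unfolding img by blast
    finally show ?thesis
      by (simp add: commuting_graph_def)
  qed
  ultimately have "graph_spectrum ?\<Gamma> = proots (char_poly (adjacency_matrix ?\<Gamma> (concat (map vs js))))"
    by (rule graph_spectrum_eq)
  also have "char_poly (adjacency_matrix ?\<Gamma> (concat (map vs js))) =
      (\<Prod>i\<leftarrow>js. char_poly (adjacency_matrix ?\<Gamma> (vs i)))"
    using distinct_js
  proof (rule char_poly_adjacency_matrix_concat)
    show "(x, y) \<notin> parcs ?\<Gamma>"
      if "i \<in> set js" "j \<in> set js" "i \<noteq> j" "x \<in> set (vs i)" "y \<in> set (vs j)" for i j x y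
      using that arc[of i j x y] unfolding set_js by blast
  qed
  also have "\<dots> = (\<Prod>i = 1..n. char_poly (adjacency_matrix ?\<Gamma> (vs i)))"
    unfolding set_js[symmetric] using distinct_js by (rule prod.distinct_set_conv_list[symmetric])
  also have "proots \<dots> = (\<Sum>i = 1..n. proots (char_poly (adjacency_matrix ?\<Gamma> (vs i))))"
  proof (rule proots_prod)
    \<comment> \<open>Characteristic polynomials are monic, hence nonzero.\<close>
    show "char_poly (adjacency_matrix ?\<Gamma> (vs i)) \<noteq> 0" for i
      using degree_monic_char_poly[of "adjacency_matrix ?\<Gamma> (vs i)" "length (vs i)"]
      by (auto simp: adjacency_matrix_def)
  qed
  also have "\<dots> = (\<Sum>i = 1..n. add_mset (of_nat (m i)) (replicate_mset (m i) (- 1)))"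
  proof (rule sum.cong[OF refl])
    fix i
    assume i: "i \<in> {1..n}"
    then have "length (vs i) = Suc (m i)"
      using vs[OF i] cardX[OF i] by (metis distinct_card)
    then show "proots (char_poly (adjacency_matrix ?\<Gamma> (vs i))) =
        add_mset (of_nat (m i)) (replicate_mset (m i) (- 1))"
      using vs[OF i] arc[OF i i] by (intro proots_complete_graph) simp_all
  qed
  also have "\<dots> = replicate_mset (\<Sum>i = 1..n. m i) (- 1) + {# of_nat (m i). i \<in># mset_set {1..n} #}"
  \<comment> \<open>Adding one clique at a time gathers the copies of -1 apart from the eigenvalues
    \<open>m i\<close>.\<close>
  proof (induction n)
    case (Suc n)
    have "replicate_mset (a + b) c = replicate_mset a c + replicate_mset b c" for a b and c :: complex
      by (rule multiset_eqI) simp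
    with Suc show ?case
      by (simp add: atLeastAtMostSuc_conv ac_simps)
  qed simp
  \<comment> \<open>By \<open>cardX\<close>, the natural number \<open>m i\<close> agrees with the
    difference taken in the complex numbers.\<close>
  also have "{# of_nat (m i). i \<in># mset_set {1..n} #} =
      {# of_nat (card (X i)) - of_nat (card ?Z) - (1 :: complex). i \<in># mset_set {1..n} #}"
    using cardX by (intro image_mset_cong) simp
  finally show ?thesis
    unfolding sumX by simp
qed

end
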